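(* Let $\mathcal{M}=(\mathbf{X},\mathbf{C},\mathbf{R})$ be a propositional MRF with hard formula $F_{\mathcal{M}}$ and soft-clause functions $\phi_1,\dots,\phi_m$. Let $Q$ be a probability distribution on the truth assignments $\mathbf{x}\in\{0,1\}^n$ to $\mathbf{X}$ such that $Q(\mathbf{x})>0$ for every $\mathbf{x}\in Sol(F_{\mathcal{M}})$. Let $\mathbf{H}=\{H_1,\dots,H_r\}$ be a set of propositional formulas over $\mathbf{X}$ such that every consistent truth assignment $\mathbf{h}\in\{0,1\}^r$ to $\mathbf{H}$ evaluates each soft clause of $\mathcal{M}$ to either True or False. Define $$U(\mathbf{h})=\sum_{\mathbf{x}\in Sol(F_{\mathbf{h}}\wedge F_{\mathcal{M}})}Q(\mathbf{x}),\qquad \mathbf{h}\in\{0,1\}^r,$$ and suppose that $U$ is a probability distribution on $\{0,1\}^r$. For $N\ge 1$ let $\mathbf{x}^{(1)},\dots,\mathbf{x}^{(N)}$ be i.i.d. samples from $Q$, let $\mathbf{h}^{(1)},\dots,\mathbf{h}^{(N)}$ be i.i.d. samples from $U$, and set $$\widehat{Z}_N=\frac1N\sum_{i=1}^N\frac{I(\mathbf{x}^{(i)})\prod_{j=1}^m\phi_j(\mathbf{x}^{(i)})}{Q(\mathbf{x}^{(i)})},\qquad \widetilde{Z}_N=\frac1N\sum_{i=1}^N\frac{\#(F_{\mathbf{h}^{(i)}}\wedge F_{\mathcal{M}})\,\prod_{j=1}^m\phi_j(\mathbf{x}_{\mathbf{h}^{(i)}})}{U(\mathbf{h}^{(i)})}.$$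 Then the variance of $\widetilde{Z}_N$ is less than or equal to the variance of $\widehat{Z}_N$.
   Context: A propositional MRF (PropMRF) is a triple $\mathcal{M}=(\mathbf{X},\mathbf{C},\mathbf{R})$, where $\mathbf{X}=\{X_1,\dots,X_n\}$ is a finite set of Boolean variables, $\mathbf{C}=\{(C_1,w_1),\dots,(C_m,w_m)\}$ is a finite set of soft clauses (each $C_i$ is a clause, i.e. a disjunction of literals over $\mathbf{X}$, and $w_i\in\mathbb{R}$), and $\mathbf{R}=\{R_1,\dots,R_p\}$ is a finite set of hard clauses. The hard formula is $F_{\mathcal{M}}=R_1\wedge\dots\wedge R_p$. For a propositional formula $F$ over $\mathbf{X}$, $Sol(F)\subseteq\{0,1\}^n$ is the set of truth assignments to all variables of $\mathbf{X}$ that make $F$ True, and $\#(F)=|Sol(F)|$. For each soft clause, $\phi_i(\mathbf{x})=\exp(w_i)$ if $\mathbf{x}$ makes $C_i$ True, and $\phi_i(\mathbf{x})=1$ otherwise. $I(\mathbf{x})=1$ if $\mathbf{x}\in Sol(F_{\mathcal{M}})$ and $I(\mathbf{x})=0$ otherwise. For $\mathbf{h}=(h_1,\dots,h_r)\in\{0,1\}^r$, $F_{\mathbf{h}}$ is the conjunction $(H_1=h_1)\wedge\dots\wedge(H_r=h_r)$, where $(H_k=1)$ means $H_k$ and $(H_k=0)$ means $\neg H_k$. The assignment $\mathbf{h}$ is consistent if $F_{\mathbf{h}}\wedge F_{\mathcal{M}}$ is satisfiable. That a consistent $\mathbf{h}$ evaluates each soft clause to either True or False means: for each $i$, $C_i$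 has the same truth value on all elements of $Sol(F_{\mathbf{h}}\wedge F_{\mathcal{M}})$. For consistent $\mathbf{h}$, $\mathbf{x}_{\mathbf{h}}$ denotes any element of $Sol(F_{\mathbf{h}}\wedge F_{\mathcal{M}})$; the value $\prod_j\phi_j(\mathbf{x}_{\mathbf{h}})$ does not depend on the choice. Inconsistent $\mathbf{h}$ have $U(\mathbf{h})=0$ and are never sampled. *)

theory Defs
  imports "HOL-Probability.Probability"
begin

datatype 'v form =
    Bot | Top | Atom 'v | Neg "'v form"
  | Conj "'v form" "'v form" | Disj "'v form" "'v form"
  | Impl "'v form" "'v form" | Equiv "'v form" "'v form"

type_synonym 'v assignment = "'v \<Rightarrow> bool"

primrec holds :: "'v assignment \<Rightarrow> 'v form \<Rightarrow> bool" where
  "holds x Bot = False"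
| "holds x Top = True"
| "holds x (Atom v) = x v"
| "holds x (Neg F) = (\<not> holds x F)"
| "holds x (Conj F G) = (holds x F \<and> holds x G)"
| "holds x (Disj F G) = (holds x F \<or> holds x G)"
| "holds x (Impl F G) = (holds x F \<longrightarrow> holds x G)"
| "holds x (Equiv F G) = (holds x F \<longleftrightarrow> holds x G)"

definition big_conj :: "'v form list \<Rightarrow> 'v form" where
  "big_conj Fs = foldr Conj Fs Top"

definition big_disj :: "'v form list \<Rightarrow> 'v form" where
  "big_disj Fs = foldr Disj Fs Bot"

datatype 'v literal = Pos_lit 'v | Neg_lit 'v

type_synonym 'v clause = "'v literal list"

primrec lit_form :: "'v literal \<Rightarrow> 'v form" where
  "lit_form (Pos_lit v) = Atom v"
| "lit_form (Neg_lit v) = Neg (Atom v)"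

definition clause_form :: "'v clause \<Rightarrow> 'v form" where
  "clause_form C = big_disj (map lit_form C)"

text \<open>
  Truth assignments to a set of variables \<open>V\<close> are the functions on \<open>V\<close>, represented
  extensionally (\<open>undefined\<close> off \<open>V\<close>) so that there are exactly \<open>2 ^ card V\<close> of them.
\<close>

definition assignments :: "'v set \<Rightarrow> 'v assignment set" where
  "assignments V = V \<rightarrow>\<^sub>E UNIV"

definition Sol :: "'v set \<Rightarrow> 'v form \<Rightarrow> 'v assignment set" where
  "Sol V F = {x \<in> assignments V. holds x F}"

text \<open>
  Soft and hard clauses are given as enumerated families. Repeated entries are allowed;
  finite sets of clauses are the families without repetition.
\<close>

record 'v prop_mrf =
  vars :: "'v set"
  soft :: "('v clause \<times> real) list"
  hard :: "'v clause list"

definition prop_mrf :: "'v prop_mrf \<Rightarrow> bool" where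
  "prop_mrf M \<longleftrightarrow> finite (vars M)
     \<and> (\<forall>(C, w) \<in> set (soft M). set_form (clause_form C) \<subseteq> vars M)
     \<and> (\<forall>R \<in> set (hard M). set_form (clause_form R) \<subseteq> vars M)"

definition hard_form :: "'v prop_mrf \<Rightarrow> 'v form" where
  "hard_form M = big_conj (map clause_form (hard M))"

definition soft_fun :: "'v clause \<times> real \<Rightarrow> 'v assignment \<Rightarrow> real" where
  "soft_fun Cw x = (if holds x (clause_form (fst Cw)) then exp (snd Cw) else 1)"

definition soft_prod :: "'v prop_mrf \<Rightarrow> 'v assignment \<Rightarrow> real" where
  "soft_prod M x = (\<Prod>j<length (soft M). soft_fun (soft M ! j) x)"

definition hard_ind :: "'v prop_mrf \<Rightarrow> 'v assignment \<Rightarrow> real" where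
  "hard_ind M x = indicator (Sol (vars M) (hard_form M)) x"

text \<open>
  A truth assignment \<open>h\<close> to the formulas \<open>Hs\<close> is a Boolean list of the same length.
\<close>

definition bool_vecs :: "nat \<Rightarrow> bool list set" where
  "bool_vecs r = {h. length h = r}"

definition assign_form :: "'v form list \<Rightarrow> bool list \<Rightarrow> 'v form" where
  "assign_form Hs h = big_conj (map2 (\<lambda>H b. if b then H else Neg H) Hs h)"

definition class_sol :: "'v prop_mrf \<Rightarrow> 'v form list \<Rightarrow> bool list \<Rightarrow> 'v assignment set" where
  "class_sol M Hs h = Sol (vars M) (Conj (assign_form Hs h) (hard_form M))"

definition consistent :: "'v prop_mrf \<Rightarrow> 'v form list \<Rightarrow> bool list \<Rightarrow> bool" where
  "consistent M Hs h \<longleftrightarrow> class_sol M Hs h \<noteq> {}"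

definition evaluates_soft :: "'v prop_mrf \<Rightarrow> 'v form list \<Rightarrow> bool list \<Rightarrow> bool" where
  "evaluates_soft M Hs h \<longleftrightarrow> (\<forall>(C, w) \<in> set (soft M).
     (\<forall>x \<in> class_sol M Hs h. holds x (clause_form C)) \<or>
     (\<forall>x \<in> class_sol M Hs h. \<not> holds x (clause_form C)))"

definition U_mass ::
  "'v prop_mrf \<Rightarrow> 'v form list \<Rightarrow> 'v assignment pmf \<Rightarrow> bool list \<Rightarrow> real" where
  "U_mass M Hs Q h = (\<Sum>x \<in> class_sol M Hs h. pmf Q x)"

definition iid_samples :: "'a measure \<Rightarrow> nat \<Rightarrow> (nat \<Rightarrow> 'a \<Rightarrow> 'b) \<Rightarrow> 'b pmf \<Rightarrow> bool" where
  "iid_samples P N Y D \<longleftrightarrow> prob_space P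
     \<and> prob_space.indep_vars P (\<lambda>_. count_space UNIV) Y {1..N}
     \<and> (\<forall>i \<in> {1..N}. distr P (count_space UNIV) (Y i) = measure_pmf D)"

definition Z_hat ::
  "'v prop_mrf \<Rightarrow> 'v assignment pmf \<Rightarrow> nat \<Rightarrow> (nat \<Rightarrow> 'a \<Rightarrow> 'v assignment) \<Rightarrow> 'a \<Rightarrow> real" where
  "Z_hat M Q N x \<omega> =
     (1 / real N) * (\<Sum>i = 1..N. hard_ind M (x i \<omega>) * soft_prod M (x i \<omega>) / pmf Q (x i \<omega>))"

text \<open>
  The argument \<open>rep\<close> selects the representative \<open>x\<^sub>h\<close> of each consistent \<open>h\<close>.
\<close>

definition Z_tilde ::
  "'v prop_mrf \<Rightarrow> 'v form list \<Rightarrow> bool list pmf \<Rightarrow> (bool list \<Rightarrow> 'v assignment) \<Rightarrow> nat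
     \<Rightarrow> (nat \<Rightarrow> 'a \<Rightarrow> bool list) \<Rightarrow> 'a \<Rightarrow> real" where
  "Z_tilde M Hs U rep N h \<omega> =
     (1 / real N) * (\<Sum>i = 1..N. real (card (class_sol M Hs (h i \<omega>)))
        * soft_prod M (rep (h i \<omega>)) / pmf U (h i \<omega>))"

end

theory Submission
  imports Defs
begin

text \<open>
  A consistent \<open>h\<close> makes the unnormalised weight constant on its class of solutions, so the
  \<open>h\<close>-estimator is the conditional expectation of the \<open>x\<close>-estimator given the class. The means
  agree, and Cauchy--Schwarz on each class compares the second moments.
\<close>

text \<open>After centring, the square of the sum expands into a double sum. Independence kills the
  off-diagonal terms, and the \<open>N\<close> diagonal ones each contribute the variance of one
  sample, against a factor \<open>1 / N^2\<close>. Finite support of \<open>D\<close> makes every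
  real function of a sample integrable.\<close>

lemma variance_iid_mean:
  fixes g :: "'b \<Rightarrow> real"
  assumes "iid_samples P N Y D" "finite (set_pmf D)" "N \<ge> 1"
  shows "prob_space.variance P (\<lambda>\<omega>. (1 / real N) * (\<Sum>i = 1..N. g (Y i \<omega>)))
           = measure_pmf.variance D g / real N"
proof -
  interpret P: prob_space P
    using assms(1) by (simp add: iid_samples_def)
  have ind: "P.indep_vars (\<lambda>_. count_space UNIV) Y {1..N}"
    and dist: "\<And>i. i \<in> {1..N} \<Longrightarrow> distr P (count_space UNIV) (Y i) = measure_pmf D"
    using assms(1) by (auto simp: iid_samples_def)
  have rv: "Y i \<in> measurable P (count_space UNIV)" if "i \<in> {1..N}" for i
    using ind that by (auto simp: P.indep_vars_def)
  have int: "integrable P (\<lambda>\<omega>. f (Y i \<omega>))" if "i \<in> {1..N}" for i and f :: "'b \<Rightarrow> real"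
    using integrable_measure_pmf_finite[OF assms(2), of f] dist[OF that]
    by (metis integrable_distr_eq rv[OF that] borel_measurable_count_space)
  have expect: "P.expectation (\<lambda>\<omega>. f (Y i \<omega>)) = measure_pmf.expectation D f"
    if "i \<in> {1..N}" for i and f :: "'b \<Rightarrow> real"
    using integral_distr[OF rv[OF that], of f] dist[OF that] by simp
  define \<mu> where "\<mu> = measure_pmf.expectation D g"
  \<comment> \<open>Centring gives mean zero, so the expectation of a product of two independent
    copies factors into zeros.\<close>
  define W where "W = (\<lambda>y. g y - \<mu>)"
  have W0: "measure_pmf.expectation D W = 0"
    using integrable_measure_pmf_finite[OF assms(2), of g] by (simp add: W_def \<mu>_def)
  have prod: "integrable P (\<lambda>\<omega>. W (Y i \<omega>) * W (Y j \<omega>)) \<and>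
      P.expectation (\<lambda>\<omega>. W (Y i \<omega>) * W (Y j \<omega>)) = (if i = j then measure_pmf.variance D g else 0)"
    if ij: "i \<in> {1..N}" "j \<in> {1..N}" for i j
  proof (cases "i = j")
    case True
    then show ?thesis
      using int[OF ij(1), of "\<lambda>y. W y * W y"] expect[OF ij(1), of "\<lambda>y. W y * W y"]
      by (simp add: W_def \<mu>_def power2_eq_square)
  next
    case False
    \<comment> \<open>The library's product rule for independent families is applied to the index
      set \<open>{i, j}\<close>; since \<open>i\<close> and \<open>j\<close> differ, its product has
      exactly the two wanted factors.\<close>
    have "P.indep_vars (\<lambda>_. borel) (\<lambda>i \<omega>. W (Y i \<omega>)) {i, j}"
      by (rule P.indep_vars_compose2[OF P.indep_vars_subset[OF ind]]) (use ij in auto)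
    then have "integrable P (\<lambda>\<omega>. \<Prod>k\<in>{i, j}. W (Y k \<omega>))"
      "P.expectation (\<lambda>\<omega>. \<Prod>k\<in>{i, j}. W (Y k \<omega>)) = (\<Prod>k\<in>{i, j}. P.expectation (\<lambda>\<omega>. W (Y k \<omega>)))"
      using ij int by (auto intro!: P.indep_vars_integrable P.indep_vars_lebesgue_integral)
    then show ?thesis
      using False W0 expect[OF ij(1), of W] by simp
  qed
  have mean: "P.expectation (\<lambda>\<omega>. (1 / real N) * (\<Sum>i = 1..N. g (Y i \<omega>))) = \<mu>"
  proof -
    have "P.expectation (\<lambda>\<omega>. \<Sum>i = 1..N. g (Y i \<omega>)) = (\<Sum>i = 1..N. \<mu>)"
      using int expect by (subst Bochner_Integration.integral_sum) (auto simp: \<mu>_def)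
    then show ?thesis
      using assms(3) by simp
  qed
  have "((1 / real N) * (\<Sum>i = 1..N. g (Y i \<omega>)) - \<mu>)\<^sup>2
      = (1 / (real N)\<^sup>2) * (\<Sum>i = 1..N. \<Sum>j = 1..N. W (Y i \<omega>) * W (Y j \<omega>))" for \<omega>
  proof -
    \<comment> \<open>Here \<open>N \<ge> 1\<close> lets \<mu> be written as the average of
      \<open>N\<close> copies of itself and absorbed into the sum.\<close>
    have "(1 / real N) * (\<Sum>i = 1..N. g (Y i \<omega>)) - \<mu> = (1 / real N) * (\<Sum>i = 1..N. W (Y i \<omega>))"
      using assms(3) by (simp add: W_def sum_subtractf field_simps)
    then show ?thesis
      by (simp add: power_mult_distrib power_one_over power2_eq_square sum_product)
  qed
  then have "P.variance (\<lambda>\<omega>. (1 / real N) * (\<Sum>i = 1..N. g (Y i \<omega>)))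
      = (1 / (real N)\<^sup>2)
        * P.expectation (\<lambda>\<omega>. \<Sum>i = 1..N. \<Sum>j = 1..N. W (Y i \<omega>) * W (Y j \<omega>))"
    unfolding mean by simp
  also have "P.expectation (\<lambda>\<omega>. \<Sum>i = 1..N. \<Sum>j = 1..N. W (Y i \<omega>) * W (Y j \<omega>))
      = (\<Sum>i = 1..N. \<Sum>j = 1..N. P.expectation (\<lambda>\<omega>. W (Y i \<omega>) * W (Y j \<omega>)))"
  proof -
    have "P.expectation (\<lambda>\<omega>. \<Sum>i = 1..N. \<Sum>j = 1..N. W (Y i \<omega>) * W (Y j \<omega>))
        = (\<Sum>i = 1..N. P.expectation (\<lambda>\<omega>. \<Sum>j = 1..N. W (Y i \<omega>) * W (Y j \<omega>)))"
      by (rule Bochner_Integration.integral_sum) (use prod in auto)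
    also have "\<dots> = (\<Sum>i = 1..N. \<Sum>j = 1..N. P.expectation (\<lambda>\<omega>. W (Y i \<omega>) * W (Y j \<omega>)))"
      by (intro sum.cong refl Bochner_Integration.integral_sum) (use prod in auto)
    finally show ?thesis .
  qed
  also have "\<dots> = (\<Sum>i = 1..N. \<Sum>j = 1..N. if i = j then measure_pmf.variance D g else 0)"
    using prod by (intro sum.cong refl) blast
  also have "\<dots> = real N * measure_pmf.variance D g"
    by simp
  finally show ?thesis
    using assms(3) by (simp add: power2_eq_square)
qed

text \<open>Cauchy--Schwarz for the vectors \<open>c / sqrt (q x)\<close> and
  \<open>sqrt (q x)\<close>, whose entrywise product is the constant \<open>c\<close>. It is meant
  for \<open>A\<close> a class of solutions, \<open>q\<close> the mass of \<open>Q\<close>, and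
  \<open>c\<close> the weight shared by the class.\<close>

lemma square_card_div_sum_le:
  fixes q :: "'a \<Rightarrow> real"
  assumes "finite A" "\<And>x. x \<in> A \<Longrightarrow> q x > 0"
  shows "(real (card A) * c)\<^sup>2 / (\<Sum>x\<in>A. q x) \<le> (\<Sum>x\<in>A. c\<^sup>2 / q x)"
proof (cases "A = {}")
  case False
  have "(\<Sum>x\<in>A. c / sqrt (q x) * sqrt (q x))\<^sup>2
      \<le> (\<Sum>x\<in>A. (c / sqrt (q x))\<^sup>2) * (\<Sum>x\<in>A. (sqrt (q x))\<^sup>2)"
    by (rule Cauchy_Schwarz_ineq_sum)
  moreover have "(\<Sum>x\<in>A. c / sqrt (q x) * sqrt (q x)) = (\<Sum>x\<in>A. c)"
    using assms(2) by (intro sum.cong) (auto dest!: assms(2))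
  moreover have "(\<Sum>x\<in>A. (c / sqrt (q x))\<^sup>2) = (\<Sum>x\<in>A. c\<^sup>2 / q x)"
    using assms(2) by (intro sum.cong) (auto simp: power_divide less_imp_le)
  moreover have "(\<Sum>x\<in>A. (sqrt (q x))\<^sup>2) = (\<Sum>x\<in>A. q x)"
    using assms(2) by (intro sum.cong) (auto simp: less_imp_le)
  moreover have "(\<Sum>x\<in>A. q x) > 0"
    using assms False by (intro sum_pos) auto
  ultimately show ?thesis
    by (simp add: field_simps)
qed simp

lemma finite_assignments: "finite V \<Longrightarrow> finite (assignments V)"
  unfolding assignments_def by (intro finite_PiE) auto

lemma finite_bool_vecs: "finite (bool_vecs r)"
  unfolding bool_vecs_def using finite_lists_length_eq[of "UNIV :: bool set" r] by simp

lemma holds_big_conj: "holds x (big_conj Fs) \<longleftrightarrow> (\<forall>F \<in> set Fs. holds x F)"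
  by (induction Fs) (auto simp: big_conj_def)

text \<open>Since \<open>map2\<close> stops at the end of the shorter list, equal lengths ensure
  that every formula and every entry of \<open>h\<close> is constrained.\<close>

lemma holds_assign_form:
  assumes "length h = length Hs"
  shows "holds x (assign_form Hs h) \<longleftrightarrow> map (holds x) Hs = h"
  using assms
  by (induction h Hs rule: list_induct2) (auto simp: assign_form_def holds_big_conj)

text \<open>This exhibits the classes as fibres of the truth-vector map on the hard solutions, the
  form in which a sum can be grouped.\<close>

lemma class_sol_eq:
  assumes "h \<in> bool_vecs (length Hs)"
  shows "class_sol M Hs h = {x \<in> Sol (vars M) (hard_form M). map (holds x) Hs = h}"
  using assms by (auto simp: class_sol_def Sol_def bool_vecs_def holds_assign_form)

text \<open>Every hard solution has exactly one truth vector, so the classes partition the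
  solutions; inconsistent vectors contribute empty sums.\<close>

lemma sum_class_sol:
  assumes "finite (Sol (vars M) (hard_form M))"
  shows "(\<Sum>h\<in>bool_vecs (length Hs). \<Sum>x\<in>class_sol M Hs h. f x)
           = (\<Sum>x\<in>Sol (vars M) (hard_form M). f x)"
proof -
  have "(\<Sum>h\<in>bool_vecs (length Hs). \<Sum>x\<in>class_sol M Hs h. f x)
      = (\<Sum>h\<in>bool_vecs (length Hs).
           \<Sum>x\<in>{x \<in> Sol (vars M) (hard_form M). map (holds x) Hs = h}. f x)"
    by (intro sum.cong refl) (simp add: class_sol_eq)
  also have "\<dots> = (\<Sum>x\<in>Sol (vars M) (hard_form M). f x)"
    by (rule sum.group[OF assms finite_bool_vecs]) (auto simp: bool_vecs_def)
  finally show ?thesis .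
qed

text \<open>Each factor sees the assignment only through the truth value of its clause, which is
  fixed on the class. This lets a representative stand for its whole class.\<close>

lemma soft_prod_eq_on_class:
  assumes "evaluates_soft M Hs h" "x \<in> class_sol M Hs h" "y \<in> class_sol M Hs h"
  shows "soft_prod M x = soft_prod M y"
  unfolding soft_prod_def
proof (rule prod.cong[OF refl])
  fix j assume "j \<in> {..<length (soft M)}"
  then have "soft M ! j \<in> set (soft M)"
    by simp
  then have "holds x (clause_form (fst (soft M ! j))) \<longleftrightarrow> holds y (clause_form (fst (soft M ! j)))"
    using assms unfolding evaluates_soft_def by (auto simp: case_prod_beta)
  then show "soft_fun (soft M ! j) x = soft_fun (soft M ! j) y"
    by (simp add: soft_fun_def)
qed

theorem theorem1:
  fixes M :: "'v prop_mrf"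
    and Q :: "'v assignment pmf"
    and Hs :: "'v form list"
    and U :: "bool list pmf"
    and rep :: "bool list \<Rightarrow> 'v assignment"
    and P :: "'a measure" and x :: "nat \<Rightarrow> 'a \<Rightarrow> 'v assignment"
    and P' :: "'b measure" and h :: "nat \<Rightarrow> 'b \<Rightarrow> bool list"
    and N :: nat
  assumes "prop_mrf M"
    and "set_pmf Q \<subseteq> assignments (vars M)"
    and "\<And>y. y \<in> Sol (vars M) (hard_form M) \<Longrightarrow> pmf Q y > 0"
    and "\<And>H. H \<in> set Hs \<Longrightarrow> set_form H \<subseteq> vars M"
    and "\<And>g. g \<in> bool_vecs (length Hs) \<Longrightarrow> consistent M Hs g \<Longrightarrow> evaluates_soft M Hs g"
    and "set_pmf U \<subseteq> bool_vecs (length Hs)"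
    and "\<And>g. g \<in> bool_vecs (length Hs) \<Longrightarrow> pmf U g = U_mass M Hs Q g"
    and "\<And>g. g \<in> bool_vecs (length Hs) \<Longrightarrow> consistent M Hs g \<Longrightarrow> rep g \<in> class_sol M Hs g"
    and "N \<ge> 1"
    and "iid_samples P N x Q"
    and "iid_samples P' N h U"
  shows "prob_space.variance P' (Z_tilde M Hs U rep N h) \<le> prob_space.variance P (Z_hat M Q N x)"
proof -
  define S where "S = Sol (vars M) (hard_form M)"
  define B where "B = bool_vecs (length Hs)"
  define p where "p = soft_prod M"
  \<comment> \<open>\<open>f\<close> and \<open>g\<close> are the one-sample terms that the two
    estimators average.\<close>
  define f where "f y = hard_ind M y * p y / pmf Q y" for y
  define g where "g b = real (card (class_sol M Hs b)) * p (rep b) / pmf U b" for b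
  have finA: "finite (assignments (vars M))"
    using assms(1) by (simp add: prop_mrf_def finite_assignments)
  have finS: "finite S"
    using finA by (simp add: S_def Sol_def)
  have finB: "finite B"
    by (simp add: B_def finite_bool_vecs)
  have finQ: "finite (set_pmf Q)" and finU: "finite (set_pmf U)"
    using assms(2,6) finA finB finite_subset by (auto simp: B_def)
  have Qpos: "pmf Q y > 0" if "y \<in> S" for y
    using assms(3) that by (simp add: S_def)
  have class_S: "class_sol M Hs b \<subseteq> S" if "b \<in> B" for b
    using that by (auto simp: B_def S_def class_sol_eq)
  have fin_class: "finite (class_sol M Hs b)" if "b \<in> B" for b
    using class_S[OF that] finS finite_subset by blast
  have Usum: "pmf U b = (\<Sum>y\<in>class_sol M Hs b. pmf Q y)" if "b \<in> B" for b
    using assms(7) that by (simp add: B_def U_mass_def)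
  have pconst: "p y = p (rep b)" if "b \<in> B" "y \<in> class_sol M Hs b" for b y
  proof -
    have "consistent M Hs b"
      using that by (auto simp: consistent_def)
    then show ?thesis
      unfolding p_def using that assms(5,8) by (intro soft_prod_eq_on_class) (auto simp: B_def)
  qed

  have f_eq: "f y = (if y \<in> S then p y / pmf Q y else 0)" for y
    by (simp add: f_def hard_ind_def S_def)
  \<comment> \<open>The indicator vanishes off \<open>S\<close>, so \<open>S\<close> carries both
    expectations. Weighting by \<open>pmf Q y\<close> cancels the denominator in the mean and leaves
    one copy of it in the second moment.\<close>
  have mean_f: "measure_pmf.expectation Q f = (\<Sum>y\<in>S. p y)"
    by (subst integral_measure_pmf_real[OF finS])
      (auto simp: f_eq less_imp_neq[OF Qpos, symmetric] split: if_splits intro!: sum.cong)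
  have second_f: "measure_pmf.expectation Q (\<lambda>y. (f y)\<^sup>2) = (\<Sum>y\<in>S. (p y)\<^sup>2 / pmf Q y)"
    by (subst integral_measure_pmf_real[OF finS])
      (auto simp: f_eq power2_eq_square less_imp_neq[OF Qpos, symmetric] split: if_splits
        intro!: sum.cong)

  have U_class: "g b * pmf U b = (\<Sum>y\<in>class_sol M Hs b. p y)
      \<and> (g b)\<^sup>2 * pmf U b \<le> (\<Sum>y\<in>class_sol M Hs b. (p y)\<^sup>2 / pmf Q y)" if b: "b \<in> B" for b
  proof (cases "class_sol M Hs b = {}")
    \<comment> \<open>For inconsistent \<open>b\<close> the cardinality is 0, so \<open>g b\<close>
      is 0 whatever value \<open>rep b\<close> takes.\<close>
    case True
    then show ?thesis
      by (simp add: g_def)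
  next
    case False
    have Upos: "pmf U b > 0"
      unfolding Usum[OF b] using False fin_class[OF b] class_S[OF b] Qpos
      by (intro sum_pos) auto
    \<comment> \<open>One factor \<open>pmf U b\<close> cancels; the one left in the denominator is
      the \<open>Q\<close>-mass of the class, as Cauchy--Schwarz requires.\<close>
    have "(g b)\<^sup>2 * pmf U b
        = (real (card (class_sol M Hs b)) * p (rep b))\<^sup>2 / (\<Sum>y\<in>class_sol M Hs b. pmf Q y)"
      using Upos by (simp add: g_def power2_eq_square flip: Usum[OF b])
    also have "\<dots> \<le> (\<Sum>y\<in>class_sol M Hs b. (p (rep b))\<^sup>2 / pmf Q y)"
      using fin_class[OF b] class_S[OF b] Qpos by (intro square_card_div_sum_le) auto
    also have "\<dots> = (\<Sum>y\<in>class_sol M Hs b. (p y)\<^sup>2 / pmf Q y)"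
      using pconst[OF b] by (intro sum.cong) auto
    finally have "(g b)\<^sup>2 * pmf U b \<le> (\<Sum>y\<in>class_sol M Hs b. (p y)\<^sup>2 / pmf Q y)" .
    moreover have "g b * pmf U b = (\<Sum>y\<in>class_sol M Hs b. p y)"
      using Upos pconst[OF b] by (simp add: g_def)
    ultimately show ?thesis
      by simp
  qed
  have regroup: "(\<Sum>b\<in>B. \<Sum>y\<in>class_sol M Hs b. k y) = (\<Sum>y\<in>S. k y)" for k :: "_ \<Rightarrow> real"
    using sum_class_sol finS unfolding B_def S_def by blast
  have B_supp: "b \<in> B" if "b \<in> set_pmf U" for b
    using assms(6) that by (auto simp: B_def)
  \<comment> \<open>Summing the class identities over the partition shows both estimators to have
    the same mean, the partition function.\<close>
  have "measure_pmf.expectation U g = (\<Sum>b\<in>B. g b * pmf U b)"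
    using B_supp by (intro integral_measure_pmf_real[OF finB])
  also have "\<dots> = (\<Sum>y\<in>S. p y)"
    using U_class by (simp flip: regroup)
  finally have mean_g: "measure_pmf.expectation U g = (\<Sum>y\<in>S. p y)" .
  have "measure_pmf.expectation U (\<lambda>b. (g b)\<^sup>2) = (\<Sum>b\<in>B. (g b)\<^sup>2 * pmf U b)"
    using B_supp by (intro integral_measure_pmf_real[OF finB])
  also have "\<dots> \<le> (\<Sum>b\<in>B. \<Sum>y\<in>class_sol M Hs b. (p y)\<^sup>2 / pmf Q y)"
    using U_class by (intro sum_mono) auto
  finally have second_g: "measure_pmf.expectation U (\<lambda>b. (g b)\<^sup>2) \<le> (\<Sum>y\<in>S. (p y)\<^sup>2 / pmf Q y)"
    by (simp only: regroup)

  \<comment> \<open>Variance is second moment minus squared mean; the means agree, so the second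
    moments decide.\<close>
  have "measure_pmf.variance U g \<le> measure_pmf.variance Q f"
    using mean_f second_f mean_g second_g
      measure_pmf.variance_eq[of U g] measure_pmf.variance_eq[of Q f]
    by (simp add: integrable_measure_pmf_finite finQ finU)
  then have "measure_pmf.variance U g / real N \<le> measure_pmf.variance Q f / real N"
    by (rule divide_right_mono) simp
  moreover have "Z_tilde M Hs U rep N h = (\<lambda>\<omega>. (1 / real N) * (\<Sum>i = 1..N. g (h i \<omega>)))"
    by (simp add: fun_eq_iff Z_tilde_def g_def p_def)
  moreover have "Z_hat M Q N x = (\<lambda>\<omega>. (1 / real N) * (\<Sum>i = 1..N. f (x i \<omega>)))"
    by (simp add: fun_eq_iff Z_hat_def f_def p_def)
  ultimately show ?thesis
    using variance_iid_mean[OF assms(10) finQ assms(9), of f]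
      variance_iid_mean[OF assms(11) finU assms(9), of g] by simp
qed

end
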